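(* Let $m$ be a positive integer, $h>0$, and let $X$ be a discrete random variable, all of whose absolute moments exist, with $$P\left(X=\frac{ih}{m}\right)=\frac hm f\left(\frac{ih}{m}\right),\quad i\in\mathbb Z,\qquad f\left(\frac{ih}{m}\right)\ge0\ \ \forall i\in\mathbb Z,\qquad \sum_{i\in\mathbb Z}\frac hm f\left(\frac{ih}m\right)=1 .$$ For every nonnegative integer $n$ put $$a_n=\frac hm\sum_{s\in\mathbb Z}\left(\frac{sh}m\right)^n f\left(\frac{sh}m\right),\qquad \tilde a_n=\frac1m\sum_{j=0}^{m-1}\frac hm\sum_{s\in\mathbb Z}\left(\frac{sh}m-\frac{m-1-2j}{2m}h\right)^n f\left(\frac{sh}m\right).$$ If the sequence $\{\tilde a_n\}$ is umbrally represented by the umbra $\tilde\alpha$ and the sequence $\{a_n\}$ is umbrally represented by the umbra $\alpha$, then $$\tilde\alpha\equiv\alpha+h\left(-1\boldsymbol{.}\iota-\tfrac12\right)+\frac hm\left(\iota+\tfrac12\right),$$ where $\iota$ is the Bernoulli umbra and $-1\boldsymbol{.}\iota$ is its inverse.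
   Context: Classical umbral calculus: there is an alphabet $A$ of symbols called umbrae, the polynomial ring $\mathcal R=\mathbb R[x]$, and a linear functional $E:\mathcal R[A]\to\mathcal R$ (evaluation) with $E[1]=1$ and $E[x^n\alpha^i\beta^j\cdots\gamma^k]=x^nE[\alpha^i]E[\beta^j]\cdots E[\gamma^k]$ for any distinct umbrae $\alpha,\beta,\dots,\gamma\in A$ and nonnegative integers $n,i,j,\dots,k$ (distinct umbrae are uncorrelated). There is an umbra $\varepsilon\in A$ (augmentation) with $E[\varepsilon^n]=\delta_{0,n}$. The umbra $\alpha$ umbrally represents the sequence $a_0=1,a_1,a_2,\dots$ if $E[\alpha^n]=a_n$ for all $n\ge0$. For umbral polynomials $p,q\in\mathcal R[A]$, $p\simeq q$ means $E[p]=E[q]$, and $p\equiv q$ (similarity) means $p^n\simeq q^n$ for all integers $n\ge 0$. The inverse $-1\boldsymbol{.}\gamma$ of an umbra $\gamma$ is an umbra uncorrelated with $\gamma$ such that $\gamma+(-1\boldsymbol{.}\gamma)\equiv\varepsilon$ (unique up to similarity). The Bernoulli umbra $\iota$ is the umbra (unique up to similarity) with $E[\iota^n]=B_n$ for all $n\ge0$, where $\{B_n\}$ are the Bernoulli numbers, $\sum_{n\ge0}B_nt^n/n!=t/(e^t-1)$ (so $B_1=-1/2$). The umbra $\alpha$ is distinct from (hence uncorrelated with) $\iota$ and $-1\boldsymbol{.}\iota$. *)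

theory Defs
  imports
    "HOL-Probability.Probability"
    "HOL-Library.Poly_Mapping"
    "HOL-Computational_Algebra.Computational_Algebra"
begin

text \<open>
  The alphabet of umbrae is a type \<open>'u\<close>. An umbral polynomial, i.e. an element of
  \<open>\<real>[x][A]\<close>, is a finitely supported function from monomials (finitely supported exponent
  functions on the alphabet) to coefficients in \<open>\<real>[x]\<close>; the product on this type is convolution.
\<close>

type_synonym 'u umbral_poly = "('u \<Rightarrow>\<^sub>0 nat) \<Rightarrow>\<^sub>0 real poly"

definition umb :: "'u \<Rightarrow> 'u umbral_poly" where
  "umb \<alpha> = Poly_Mapping.single (Poly_Mapping.single \<alpha> 1) 1"

definition base_poly :: "real poly \<Rightarrow> 'u umbral_poly" where
  "base_poly c = Poly_Mapping.single 0 c"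

definition real_const :: "real \<Rightarrow> 'u umbral_poly" where
  "real_const c = base_poly [:c:]"

locale umbral_calculus =
  fixes E :: "'u umbral_poly \<Rightarrow> real poly"
    and \<epsilon> :: 'u
  assumes eval_add: "E (p + q) = E p + E q"
    and eval_scale: "E (real_const c * p) = smult c (E p)"
    and eval_one: "E 1 = 1"
    and eval_monomial: "finite S \<Longrightarrow>
      E (base_poly (monom 1 n) * (\<Prod>\<alpha>\<in>S. umb \<alpha> ^ k \<alpha>)) = monom 1 n * (\<Prod>\<alpha>\<in>S. E (umb \<alpha> ^ k \<alpha>))"
    and eval_augmentation: "E (umb \<epsilon> ^ n) = (if n = 0 then 1 else 0)"

definition umbrally_represents ::
    "('u umbral_poly \<Rightarrow> real poly) \<Rightarrow> 'u \<Rightarrow> (nat \<Rightarrow> real poly) \<Rightarrow> bool" where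
  "umbrally_represents E \<alpha> a \<longleftrightarrow> (\<forall>n. E (umb \<alpha> ^ n) = a n)"

definition umbrally_equivalent ::
    "('u umbral_poly \<Rightarrow> real poly) \<Rightarrow> 'u umbral_poly \<Rightarrow> 'u umbral_poly \<Rightarrow> bool" where
  "umbrally_equivalent E p q \<longleftrightarrow> E p = E q"

definition similar ::
    "('u umbral_poly \<Rightarrow> real poly) \<Rightarrow> 'u umbral_poly \<Rightarrow> 'u umbral_poly \<Rightarrow> bool" where
  "similar E p q \<longleftrightarrow> (\<forall>n. umbrally_equivalent E (p ^ n) (q ^ n))"

definition uncorrelated :: "('u umbral_poly \<Rightarrow> real poly) \<Rightarrow> 'u \<Rightarrow> 'u \<Rightarrow> bool" where
  "uncorrelated E \<alpha> \<beta> \<longleftrightarrow> (\<forall>i j. E (umb \<alpha> ^ i * umb \<beta> ^ j) = E (umb \<alpha> ^ i) * E (umb \<beta> ^ j))"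

text \<open>The inverse of an umbra \<open>\<gamma>\<close> is determined only up to similarity, so it is a predicate.\<close>

definition inverse_umbra ::
    "('u umbral_poly \<Rightarrow> real poly) \<Rightarrow> 'u \<Rightarrow> 'u \<Rightarrow> 'u \<Rightarrow> bool" where
  "inverse_umbra E \<epsilon> \<gamma> \<delta> \<longleftrightarrow> uncorrelated E \<gamma> \<delta> \<and> similar E (umb \<gamma> + umb \<delta>) (umb \<epsilon>)"

text \<open>
  The Bernoulli numbers, from \<open>\<Sum>n. B n * t^n / n! = t / (exp t - 1)\<close>. Division on formal power
  series over a field cancels the common factor \<open>t\<close> here, see the two lemmas below.
\<close>

definition bernoulli :: "nat \<Rightarrow> real" where
  "bernoulli n = fact n * fps_nth (fps_X / (fps_exp 1 - 1)) n"

definition bernoulli_umbra :: "('u umbral_poly \<Rightarrow> real poly) \<Rightarrow> 'u \<Rightarrow> bool" where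
  "bernoulli_umbra E \<iota> \<longleftrightarrow> umbrally_represents E \<iota> (\<lambda>n. [:bernoulli n:])"

lemma bernoulli_egf:
  "Abs_fps (\<lambda>n. bernoulli n / fact n) * (fps_exp 1 - 1) = fps_X"
proof -
  have nz: "(fps_exp 1 - 1 :: real fps) $ 1 \<noteq> 0" by simp
  have sd: "subdegree (fps_exp 1 - 1 :: real fps) = 1"
    by (rule subdegreeI) auto
  have "(fps_exp 1 - 1 :: real fps) dvd fps_X"
    by (subst fps_dvd_iff) (use nz sd in auto)
  then have "fps_X / (fps_exp 1 - 1) * (fps_exp 1 - 1 :: real fps) = fps_X"
    by simp
  moreover have "Abs_fps (\<lambda>n. bernoulli n / fact n) = fps_X / (fps_exp 1 - 1)"
    by (rule fps_ext) (simp add: bernoulli_def)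
  ultimately show ?thesis by simp
qed

lemma bernoulli_0_1: "bernoulli 0 = 1" "bernoulli 1 = - 1 / 2"
proof -
  have 1: "fps_nth (Abs_fps (\<lambda>n. bernoulli n / fact n) * (fps_exp 1 - 1)) n = fps_nth fps_X n" for n
    by (simp add: bernoulli_egf)
  show B0: "bernoulli 0 = 1"
    using 1[of 1] by (simp add: fps_mult_nth)
  show "bernoulli 1 = - 1 / 2"
    using 1[of 2] B0 by (simp add: fps_mult_nth numeral_2_eq_2)
qed

end

theory Submission
  imports Defs
begin

text \<open>
  In terms of exponential generating functions, the right-hand side is a product. The inverse of
  the Bernoulli umbra has generating function \<open>(exp t - 1) / t\<close>, that is, it has the moments
  \<open>1 / (n + 1)\<close> of a uniform variable on \<open>[0, 1]\<close>. With \<open>g = h / m\<close>, the polynomial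
  \<open>h (-1.\<iota>) + g \<iota>\<close> therefore has the generating function
  \<open>(exp (h t) - 1) / (h t) * (g t / (exp (g t) - 1)) = (1 / m) (\<Sum>j<m. exp (j g t))\<close>,
  a geometric sum, which is that of a uniform variable on the grid \<open>{0, g, ..., (m - 1) g}\<close>
  (\<open>bernoulli_scaled_inverse_moments\<close>). The two constants \<open>-h / 2\<close> and \<open>g / 2\<close> centre this grid, so
  that its points become the shifts \<open>-(m - 1 - 2 j) h / (2 m)\<close>. Since \<open>\<alpha>\<close> is uncorrelated with both
  Bernoulli umbrae, adding it convolves the law of \<open>X\<close> with the centred uniform law
  (\<open>eval_uniform_grid_shift\<close>), and the moments of that convolution are the ones that
  \<open>\<alpha>'\<close> represents.

  Analysis enters only through the absolute convergence of the series for the moments of \<open>X\<close>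
  (\<open>summable_on_atoms\<close>), which allows the \<open>n\<close>-th power of a shifted lattice point to be expanded
  under the sum (\<open>has_sum_shifted_power\<close>). For the evaluation to factor over \<open>\<alpha>\<close>, \<open>\<iota>\<close> and \<open>-1.\<iota>\<close>,
  the last two must be different letters; they are, because their first moments are \<open>-1/2\<close> and
  \<open>1/2\<close>.
\<close>

section \<open>Evaluation of powers of sums of uncorrelated umbral polynomials\<close>

lemma sum_const_poly: "(\<Sum>k\<in>A. [:w k:]) = [:\<Sum>k\<in>A. w k:]"
  by (induction A rule: infinite_finite_induct) simp_all

lemma real_const_add: "real_const (a + b) = real_const a + real_const b"
  by (simp add: real_const_def base_poly_def flip: single_add)

lemma real_const_diff: "real_const (a - b) = real_const a - real_const b"
  by (simp add: real_const_def base_poly_def flip: single_diff)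

lemma real_const_mult: "real_const (a * b) = real_const a * real_const b"
  by (simp add: real_const_def base_poly_def mult_single mult.commute)

lemma real_const_1: "real_const 1 = 1"
  by (simp add: real_const_def base_poly_def flip: single_one one_pCons)

lemma real_const_power: "real_const (a ^ n) = real_const a ^ n"
  by (induction n) (simp_all add: real_const_1 real_const_mult)

lemma real_const_of_nat: "real_const (of_nat n) = of_nat n"
  by (induction n) (simp_all add: real_const_1 real_const_add, simp add: real_const_def base_poly_def)

context umbral_calculus
begin

lemma eval_zero: "E 0 = 0"
  using eval_add[of 0 0] by simp

lemma eval_sum: "E (\<Sum>i\<in>S. p i) = (\<Sum>i\<in>S. E (p i))"
  by (induction S rule: infinite_finite_induct) (simp_all add: eval_zero eval_add)

lemma eval_real_const_power: "E (real_const c ^ n) = [:c ^ n:]"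
  using eval_scale[of "c ^ n" 1] by (simp add: real_const_power eval_one)

lemma eval_scaled_power: "E ((real_const c * p) ^ n) = smult (c ^ n) (E (p ^ n))"
  by (simp add: power_mult_distrib eval_scale flip: real_const_power)

lemma eval_umb_distinct:
  assumes "\<alpha> \<noteq> \<beta>" "\<alpha> \<noteq> \<gamma>" "\<beta> \<noteq> \<gamma>"
  shows "E (umb \<alpha> ^ i * umb \<beta> ^ j * umb \<gamma> ^ k)
           = E (umb \<alpha> ^ i) * E (umb \<beta> ^ j) * E (umb \<gamma> ^ k)"
proof -
  define e where "e = (\<lambda>x. if x = \<alpha> then i else if x = \<beta> then j else k)"
  have "base_poly (monom 1 0) = (1 :: 'u umbral_poly)"
    by (simp add: base_poly_def monom_0 flip: single_one one_pCons)
  with eval_monomial[of "{\<alpha>, \<beta>, \<gamma>}" 0 e] show ?thesis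
    using assms by (simp add: e_def mult.assoc monom_0 flip: one_pCons)
qed

text \<open>
  Correlation is stated for polynomials and not only for letters, because it has to be carried
  through scaling, addition and shifting.
\<close>

definition uncorrelated_polys :: "'u umbral_poly \<Rightarrow> 'u umbral_poly \<Rightarrow> bool" where
  "uncorrelated_polys p q \<longleftrightarrow> (\<forall>i j. E (p ^ i * q ^ j) = E (p ^ i) * E (q ^ j))"

definition uncorrelated_polys3 :: "'u umbral_poly \<Rightarrow> 'u umbral_poly \<Rightarrow> 'u umbral_poly \<Rightarrow> bool" where
  "uncorrelated_polys3 p q r \<longleftrightarrow>
     (\<forall>i j k. E (p ^ i * q ^ j * r ^ k) = E (p ^ i) * E (q ^ j) * E (r ^ k))"

lemma uncorrelated_polys3_D:
  assumes "uncorrelated_polys3 p q r"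
  shows "uncorrelated_polys q r"
  unfolding uncorrelated_polys_def
proof (intro allI)
  fix i j
  show "E (q ^ i * r ^ j) = E (q ^ i) * E (r ^ j)"
    using assms[unfolded uncorrelated_polys3_def, rule_format, of 0 i j] by (simp add: eval_one)
qed

lemma uncorrelated_polys3_scale:
  assumes "uncorrelated_polys3 p q r"
  shows "uncorrelated_polys3 p (real_const b * q) (real_const c * r)"
  unfolding uncorrelated_polys3_def
proof (intro allI)
  fix i j k
  have "p ^ i * (real_const b * q) ^ j * (real_const c * r) ^ k
          = real_const (b ^ j * c ^ k) * (p ^ i * q ^ j * r ^ k)"
    by (simp add: power_mult_distrib real_const_mult real_const_power algebra_simps)
  then have "E (p ^ i * (real_const b * q) ^ j * (real_const c * r) ^ k)
          = smult (b ^ j * c ^ k) (E (p ^ i) * E (q ^ j) * E (r ^ k))"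
    using assms by (simp add: eval_scale uncorrelated_polys3_def)
  then show "E (p ^ i * (real_const b * q) ^ j * (real_const c * r) ^ k)
      = E (p ^ i) * E ((real_const b * q) ^ j) * E ((real_const c * r) ^ k)"
    by (simp add: eval_scaled_power mult.commute[of "b ^ j"])
qed

lemma uncorrelated_polys3_const:
  assumes "uncorrelated_polys p q"
  shows "uncorrelated_polys3 p q (real_const c)"
  unfolding uncorrelated_polys3_def
proof (intro allI)
  fix i j k
  have "E (p ^ i * q ^ j * real_const c ^ k) = E (real_const (c ^ k) * (p ^ i * q ^ j))"
    by (simp add: real_const_power ac_simps)
  also have "\<dots> = smult (c ^ k) (E (p ^ i) * E (q ^ j))"
    using assms by (simp add: eval_scale uncorrelated_polys_def)
  finally show "E (p ^ i * q ^ j * real_const c ^ k) = E (p ^ i) * E (q ^ j) * E (real_const c ^ k)"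
    by (simp add: eval_real_const_power)
qed

lemma eval_mult_power_add:
  "E (p * (q + r) ^ n) = (\<Sum>k\<le>n. of_nat (n choose k) * E (p * q ^ k * r ^ (n - k)))"
proof -
  have "E (p * (q + r) ^ n)
      = E (\<Sum>k\<le>n. real_const (of_nat (n choose k)) * (p * q ^ k * r ^ (n - k)))"
    by (simp add: binomial_ring sum_distrib_left real_const_of_nat ac_simps)
  also have "\<dots> = (\<Sum>k\<le>n. of_nat (n choose k) * E (p * q ^ k * r ^ (n - k)))"
    by (simp add: eval_sum eval_scale of_nat_poly)
  finally show ?thesis .
qed

lemma uncorrelated_polys3_imp_sum:
  assumes "uncorrelated_polys3 p q r"
  shows "uncorrelated_polys p (q + r)"
  unfolding uncorrelated_polys_def
proof (intro allI)
  fix i n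
  have fact3: "E (p ^ i * q ^ k * r ^ l) = E (p ^ i) * E (q ^ k) * E (r ^ l)"
    and fact2: "E (q ^ k * r ^ l) = E (q ^ k) * E (r ^ l)" for i k l
    using assms uncorrelated_polys3_D[OF assms]
    by (simp_all add: uncorrelated_polys3_def uncorrelated_polys_def)
  show "E (p ^ i * (q + r) ^ n) = E (p ^ i) * E ((q + r) ^ n)"
    using eval_mult_power_add[of 1 q r n]
    by (simp add: eval_mult_power_add[of "p ^ i"] fact3 fact2 sum_distrib_left
        mult.left_commute[of "E (p ^ i)"] mult.assoc[of "E x" for x])
qed

lemma eval_power_add:
  assumes "uncorrelated_polys p q"
  shows "E ((p + q) ^ n) = (\<Sum>k\<le>n. of_nat (n choose k) * (E (p ^ k) * E (q ^ (n - k))))"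
  using eval_mult_power_add[of 1 p q n] assms by (simp add: uncorrelated_polys_def)

lemma eval_power_add_real:
  assumes "uncorrelated_polys p q"
    and "\<And>k. E (p ^ k) = [:u k:]" and "\<And>k. E (q ^ k) = [:v k:]"
  shows "E ((p + q) ^ n) = [:\<Sum>k\<le>n. of_nat (n choose k) * u k * v (n - k):]"
  by (simp add: eval_power_add[OF assms(1)] assms(2,3) of_nat_poly sum_const_poly mult_ac)

end

section \<open>Moments of the Bernoulli umbra and of its inverse\<close>

abbreviation egf :: "(nat \<Rightarrow> real) \<Rightarrow> real fps" where
  "egf u \<equiv> Abs_fps (\<lambda>n. u n / fact n)"

lemma egf_mult:
  "egf u * egf v = egf (\<lambda>n. \<Sum>k\<le>n. of_nat (n choose k) * u k * v (n - k))"
proof (rule fps_ext)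
  fix n
  show "fps_nth (egf u * egf v) n
          = fps_nth (egf (\<lambda>n. \<Sum>k\<le>n. of_nat (n choose k) * u k * v (n - k))) n"
    by (auto simp: fps_mult_nth atMost_atLeast0 sum_divide_distrib binomial_fact field_simps
             intro!: sum.cong)
qed

lemma egf_inject: "egf u = egf v \<longleftrightarrow> u = v"
  by (auto simp: fps_eq_iff)

lemma fps_X_mult_egf_uniform:
  "fps_const c * fps_X * egf (\<lambda>n. c ^ n / (of_nat n + 1)) = fps_exp c - 1"
proof (rule fps_ext)
  fix n
  show "fps_nth (fps_const c * fps_X * egf (\<lambda>n. c ^ n / (of_nat n + 1))) n
          = fps_nth (fps_exp c - 1) n"
    by (cases n) (simp_all add: mult.assoc field_simps)
qed

lemma bernoulli_uniform_convolution:
  "(\<Sum>k\<le>n. of_nat (n choose k) * bernoulli k * (1 / (of_nat (n - k) + 1)))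
     = (if n = 0 then 1 else 0)"
proof -
  have "egf bernoulli * (fps_X * egf (\<lambda>n. 1 / (of_nat n + 1))) = fps_X"
    using fps_X_mult_egf_uniform[of 1] bernoulli_egf by simp
  then have "fps_X * (egf bernoulli * egf (\<lambda>n. 1 / (of_nat n + 1))) = fps_X * 1"
    by (simp add: ac_simps)
  then have "egf bernoulli * egf (\<lambda>n. 1 / (of_nat n + 1)) = 1"
    using fps_X_neq_zero mult_left_cancel by blast
  then have "fps_nth (egf (\<lambda>n. \<Sum>k\<le>n. of_nat (n choose k) * bernoulli k
               * (1 / (of_nat (n - k) + 1)))) n = fps_nth 1 n"
    by (simp only: egf_mult)
  then show ?thesis by (cases "n = 0") simp_all
qed

text \<open>
  With \<open>B(t)\<close> the generating function of the Bernoulli numbers, that of the left-hand side times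
  \<open>m t\<close> is \<open>B(t) (exp (m t) - 1)\<close>. Here \<open>exp (m t) - 1\<close> is \<open>exp t - 1\<close> times the geometric sum
  \<open>\<Sum>j<m. exp (j t)\<close>, and \<open>B(t) (exp t - 1) = t\<close>.
\<close>

lemma bernoulli_power_sum:
  assumes "m > 0"
  shows "(\<Sum>k\<le>n. of_nat (n choose k) * (of_nat m ^ k / (of_nat k + 1)) * bernoulli (n - k))
           = 1 / of_nat m * (\<Sum>j<m. of_nat j ^ n)"
proof -
  let ?u = "\<lambda>n. of_nat m ^ n / (of_nat n + 1) :: real"
  let ?v = "\<lambda>n. 1 / of_nat m * (\<Sum>j<m. of_nat j ^ n) :: real"
  let ?c = "fps_const (of_nat m :: real) * fps_X"
  have geometric: "fps_exp (of_nat m) - 1 = (fps_exp 1 - 1) * (\<Sum>j<m. fps_exp (of_nat j :: real))"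
    using power_diff_1_eq[of "fps_exp (1 :: real)" m] by (simp add: fps_exp_power_mult)
  have egf_v: "fps_const (of_nat m) * egf ?v = (\<Sum>j<m. fps_exp (of_nat j))"
    using assms by (intro fps_ext) (simp add: fps_sum_nth flip: sum_divide_distrib)
  have "?c * (egf ?u * egf bernoulli) = (fps_exp (of_nat m) - 1) * egf bernoulli"
    by (simp only: fps_X_mult_egf_uniform flip: mult.assoc)
  also have "\<dots> = (egf bernoulli * (fps_exp 1 - 1)) * (\<Sum>j<m. fps_exp (of_nat j))"
    by (simp only: geometric ac_simps)
  also have "\<dots> = fps_X * (fps_const (of_nat m) * egf ?v)"
    by (simp only: bernoulli_egf egf_v)
  also have "\<dots> = ?c * egf ?v"
    by (simp only: ac_simps)
  finally have "egf ?u * egf bernoulli = egf ?v"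
    using assms by (subst (asm) mult_left_cancel) auto
  then show ?thesis
    unfolding egf_mult egf_inject by (rule fun_cong)
qed

context umbral_calculus
begin

text \<open>
  Since \<open>E[\<iota>\<^sup>0] = B\<^sub>0 = 1\<close>, the defining relation of the inverse determines its moments
  recursively, and \<open>1 / (n + 1)\<close> solves the recursion.
\<close>

lemma inverse_bernoulli_moments:
  assumes \<iota>: "bernoulli_umbra E \<iota>" and inv: "inverse_umbra E \<epsilon> \<iota> \<iota>'"
  shows "E (umb \<iota>' ^ n) = [:1 / (of_nat n + 1):]"
proof (induction n rule: less_induct)
  case (less n)
  have B: "E (umb \<iota> ^ k) = [:bernoulli k:]" for k
    using \<iota> by (simp add: bernoulli_umbra_def umbrally_represents_def)
  have "uncorrelated_polys (umb \<iota>) (umb \<iota>')"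
    using inv by (simp add: inverse_umbra_def uncorrelated_def uncorrelated_polys_def)
  then have "(\<Sum>k\<le>n. of_nat (n choose k) * (E (umb \<iota> ^ k) * E (umb \<iota>' ^ (n - k))))
      = E (umb \<epsilon> ^ n)"
    using inv by (simp add: inverse_umbra_def similar_def umbrally_equivalent_def
        flip: eval_power_add)
  also have "\<dots> = [:if n = 0 then 1 else 0:]"
    by (simp add: eval_augmentation flip: one_pCons)
  also have "\<dots> = [:\<Sum>k\<le>n. of_nat (n choose k) * bernoulli k * (1 / (of_nat (n - k) + 1)):]"
    by (simp only: bernoulli_uniform_convolution)
  also have "\<dots> = (\<Sum>k\<le>n. of_nat (n choose k) * (E (umb \<iota> ^ k) * [:1 / (of_nat (n - k) + 1):]))"
    by (simp add: B of_nat_poly sum_const_poly mult.commute)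
  finally have eq: "(\<Sum>k\<le>n. of_nat (n choose k) * (E (umb \<iota> ^ k) * E (umb \<iota>' ^ (n - k))))
      = (\<Sum>k\<le>n. of_nat (n choose k) * (E (umb \<iota> ^ k) * [:1 / (of_nat (n - k) + 1):]))" .
  have "(\<Sum>k\<in>{..n} - {0}. of_nat (n choose k) * (E (umb \<iota> ^ k) * E (umb \<iota>' ^ (n - k))))
      = (\<Sum>k\<in>{..n} - {0}. of_nat (n choose k) * (E (umb \<iota> ^ k) * [:1 / (of_nat (n - k) + 1):]))"
    by (intro sum.cong refl) (simp add: less.IH)
  with eq show ?case
    by (simp add: sum.remove[of "{..n}" 0] eval_one)
qed

text \<open>
  The first moments \<open>-1/2\<close> and \<open>1/2\<close> tell the two letters apart. Distinctness is what lets the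
  evaluation factor over the pair together with a third letter.
\<close>

lemma bernoulli_umbra_neq_inverse:
  assumes "bernoulli_umbra E \<iota>" and "inverse_umbra E \<epsilon> \<iota> \<iota>'"
  shows "\<iota> \<noteq> \<iota>'"
proof -
  have "E (umb \<iota> ^ 1) = [:- 1 / 2:]"
    using assms(1)
    unfolding bernoulli_umbra_def umbrally_represents_def bernoulli_0_1(2)[symmetric] by blast
  with inverse_bernoulli_moments[OF assms, of 1] show ?thesis by auto
qed

lemma bernoulli_scaled_inverse_moments:
  assumes \<iota>: "bernoulli_umbra E \<iota>" and inv: "inverse_umbra E \<epsilon> \<iota> \<iota>'" and "m > 0"
  shows "E ((real_const (of_nat m * g) * umb \<iota>' + real_const g * umb \<iota>) ^ n)
           = [:1 / of_nat m * (\<Sum>j<m. (of_nat j * g) ^ n):]"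
proof -
  let ?b' = "\<lambda>k. (of_nat m * g) ^ k * (1 / (of_nat k + 1))" and ?b = "\<lambda>k. g ^ k * bernoulli k"
  \<comment> \<open>with \<open>1\<close> in the first place the threefold condition is the one for the pair\<close>
  have "uncorrelated_polys3 1 (umb \<iota>') (umb \<iota>)"
    using inv by (simp add: uncorrelated_polys3_def inverse_umbra_def uncorrelated_def eval_one
        mult.commute)
  then have "uncorrelated_polys (real_const (of_nat m * g) * umb \<iota>') (real_const g * umb \<iota>)"
    by (intro uncorrelated_polys3_D uncorrelated_polys3_scale)
  moreover have "E ((real_const (of_nat m * g) * umb \<iota>') ^ k) = [:?b' k:]" for k
    by (simp add: eval_scaled_power inverse_bernoulli_moments[OF \<iota> inv])
  moreover have "E ((real_const g * umb \<iota>) ^ k) = [:?b k:]" for k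
    using \<iota> by (simp add: eval_scaled_power bernoulli_umbra_def umbrally_represents_def)
  ultimately have "E ((real_const (of_nat m * g) * umb \<iota>' + real_const g * umb \<iota>) ^ n)
      = [:\<Sum>k\<le>n. of_nat (n choose k) * ?b' k * ?b (n - k):]"
    by (rule eval_power_add_real)
  also have "(\<Sum>k\<le>n. of_nat (n choose k) * ?b' k * ?b (n - k))
      = (\<Sum>k\<le>n. g ^ n *
          (of_nat (n choose k) * (of_nat m ^ k / (of_nat k + 1)) * bernoulli (n - k)))"
  proof (intro sum.cong refl)
    fix k assume "k \<in> {..n}"
    then have "g ^ n = g ^ k * g ^ (n - k)" by (simp flip: power_add)
    then show "of_nat (n choose k) * ?b' k * ?b (n - k) = g ^ n *
        (of_nat (n choose k) * (of_nat m ^ k / (of_nat k + 1)) * bernoulli (n - k))"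
      by (simp add: power_mult_distrib)
  qed
  also have "\<dots> = 1 / of_nat m * (\<Sum>j<m. (of_nat j * g) ^ n)"
    unfolding sum_distrib_left[symmetric] bernoulli_power_sum[OF \<open>m > 0\<close>]
    by (simp add: power_mult_distrib sum_distrib_right[symmetric])
  finally show ?thesis .
qed

text \<open>
  Adding an umbra that is uncorrelated with both Bernoulli umbrae, and a constant, turns every
  grid point \<open>j g\<close> into the shift \<open>j g + c\<close> of the moments of that umbra.
\<close>

lemma eval_uniform_grid_shift:
  assumes \<iota>: "bernoulli_umbra E \<iota>" and inv: "inverse_umbra E \<epsilon> \<iota> \<iota>'" and "m > 0"
    and "\<alpha> \<noteq> \<iota>" "\<alpha> \<noteq> \<iota>'" and a: "umbrally_represents E \<alpha> (\<lambda>n. [:a n:])"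
  shows "E ((umb \<alpha> +
             (real_const (of_nat m * g) * umb \<iota>' + real_const g * umb \<iota> + real_const c)) ^ n)
    = [:1 / of_nat m *
          (\<Sum>j<m. \<Sum>k\<le>n. of_nat (n choose k) * a k * (of_nat j * g + c) ^ (n - k)):]"
proof -
  let ?Y = "real_const (of_nat m * g) * umb \<iota>' + real_const g * umb \<iota>"
  have "uncorrelated_polys3 (umb \<alpha>) (umb \<iota>') (umb \<iota>)"
    using assms bernoulli_umbra_neq_inverse[OF \<iota> inv]
    by (simp add: uncorrelated_polys3_def eval_umb_distinct)
  then have "uncorrelated_polys (umb \<alpha>) ?Y"
    by (intro uncorrelated_polys3_imp_sum uncorrelated_polys3_scale)
  then have three: "uncorrelated_polys3 (umb \<alpha>) ?Y (real_const c)"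
    by (rule uncorrelated_polys3_const)
  have shifted: "E ((?Y + real_const c) ^ k)
      = [:1 / of_nat m * (\<Sum>j<m. (of_nat j * g + c) ^ k):]" for k
  proof -
    have "E ((?Y + real_const c) ^ k)
        = [:\<Sum>l\<le>k. of_nat (k choose l) * (1 / of_nat m * (\<Sum>j<m. (of_nat j * g) ^ l)) * c ^ (k - l):]"
      using uncorrelated_polys3_D[OF three] bernoulli_scaled_inverse_moments[OF \<iota> inv \<open>m > 0\<close>]
        eval_real_const_power
      by (rule eval_power_add_real)
    also have "(\<Sum>l\<le>k. of_nat (k choose l) * (1 / of_nat m * (\<Sum>j<m. (of_nat j * g) ^ l)) * c ^ (k - l))
        = 1 / of_nat m * (\<Sum>l\<le>k. \<Sum>j<m. of_nat (k choose l) * (of_nat j * g) ^ l * c ^ (k - l))"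
      by (simp add: sum_distrib_left sum_distrib_right mult_ac)
    also have "\<dots> = 1 / of_nat m * (\<Sum>j<m. (of_nat j * g + c) ^ k)"
      by (subst sum.swap) (simp only: binomial_ring)
    finally show ?thesis .
  qed
  have "E ((umb \<alpha> + (?Y + real_const c)) ^ n)
      = [:\<Sum>k\<le>n. of_nat (n choose k) * a k *
            (1 / of_nat m * (\<Sum>j<m. (of_nat j * g + c) ^ (n - k))):]"
    by (rule eval_power_add_real[OF uncorrelated_polys3_imp_sum[OF three] _ shifted])
      (use a in \<open>simp add: umbrally_represents_def\<close>)
  also have "(\<Sum>k\<le>n. of_nat (n choose k) * a k *
            (1 / of_nat m * (\<Sum>j<m. (of_nat j * g + c) ^ (n - k))))
      = 1 / of_nat m *
          (\<Sum>k\<le>n. \<Sum>j<m. of_nat (n choose k) * a k * (of_nat j * g + c) ^ (n - k))"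
    by (simp add: sum_distrib_left mult_ac)
  also have "\<dots> = 1 / of_nat m *
          (\<Sum>j<m. \<Sum>k\<le>n. of_nat (n choose k) * a k * (of_nat j * g + c) ^ (n - k))"
    by (subst sum.swap) (rule refl)
  finally show ?thesis .
qed

end

section \<open>Moments over the atoms of a random variable\<close>

text \<open>
  On finitely many distinct values, replacing \<open>g \<circ> X\<close> by zero off these values can only
  decrease the expectation; so the expectation of \<open>g \<circ> X\<close> bounds all finite partial sums.
\<close>

lemma summable_on_atoms:
  fixes X :: "'a \<Rightarrow> real" and g :: "real \<Rightarrow> real" and x :: "'i \<Rightarrow> real"
  assumes "finite_measure M" and X: "X \<in> borel_measurable M"
    and int: "integrable M (\<lambda>\<omega>. g (X \<omega>))" and nonneg: "\<And>y. g y \<ge> 0" and "inj x"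
  shows "(\<lambda>i. g (x i) * measure M {\<omega> \<in> space M. X \<omega> = x i}) summable_on UNIV"
proof (rule nonneg_bdd_above_summable_on)
  interpret finite_measure M by fact
  show "0 \<le> g (x i) * measure M {\<omega> \<in> space M. X \<omega> = x i}" for i
    using nonneg by simp
  let ?A = "\<lambda>i. {\<omega> \<in> space M. X \<omega> = x i}"
  have A: "?A i \<in> sets M" for i using X by measurable
  show "bdd_above (sum (\<lambda>i. g (x i) * measure M (?A i)) ` {F. F \<subseteq> UNIV \<and> finite F})"
  proof (rule bdd_aboveI2)
    fix F :: "'i set" assume "F \<in> {F. F \<subseteq> UNIV \<and> finite F}"
    then have F: "finite F" by simp
    have "(\<Sum>i\<in>F. g (x i) * measure M (?A i))
        = (\<integral>\<omega>. (\<Sum>i\<in>F. g (x i) * indicator (?A i) \<omega>) \<partial>M)"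
      using A by (simp add: emeasure_eq_measure Int_absorb1 sets.sets_into_space)
    also have "\<dots> \<le> (\<integral>\<omega>. g (X \<omega>) \<partial>M)"
    proof (rule integral_mono)
      show "integrable M (\<lambda>\<omega>. \<Sum>i\<in>F. g (x i) * indicator (?A i) \<omega>)"
        using A by (intro Bochner_Integration.integrable_sum integrable_mult_right)
          (simp add: emeasure_eq_measure)
      fix \<omega> assume "\<omega> \<in> space M"
      then have eq: "g (x i) * indicator (?A i) \<omega> = (if X \<omega> = x i then g (x i) else 0)" for i
        by simp
      show "(\<Sum>i\<in>F. g (x i) * indicator (?A i) \<omega>) \<le> g (X \<omega>)"
      proof (cases "\<exists>i\<in>F. X \<omega> = x i")
        case True
        then obtain k where k: "k \<in> F" "X \<omega> = x k" by blast
        have "(\<Sum>i\<in>F. g (x i) * indicator (?A i) \<omega>) = (\<Sum>i\<in>F. if i = k then g (x k) else 0)"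
          unfolding eq k(2) using \<open>inj x\<close> by (intro sum.cong refl) (auto dest: injD)
        then show ?thesis using k F by simp
      next
        case False
        then have "(\<Sum>i\<in>F. g (x i) * indicator (?A i) \<omega>) = 0"
          unfolding eq by (intro sum.neutral) auto
        then show ?thesis using nonneg by simp
      qed
    qed (rule int)
    finally show "(\<Sum>i\<in>F. g (x i) * measure M (?A i)) \<le> (\<integral>\<omega>. g (X \<omega>) \<partial>M)" .
  qed
qed

lemma has_sum_sum:
  fixes f :: "'k \<Rightarrow> 'i \<Rightarrow> 'b :: topological_comm_monoid_add"
  assumes "\<And>k. k \<in> K \<Longrightarrow> (f k has_sum s k) A"
  shows "((\<lambda>i. \<Sum>k\<in>K. f k i) has_sum (\<Sum>k\<in>K. s k)) A"
  using assms by (induction K rule: infinite_finite_induct) (simp_all add: has_sum_add)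

lemma has_sum_shifted_power:
  fixes x w :: "'i \<Rightarrow> real"
  assumes "\<And>k. ((\<lambda>i. x i ^ k * w i) has_sum a k) A"
  shows "((\<lambda>i. (x i + d) ^ n * w i) has_sum (\<Sum>k\<le>n. of_nat (n choose k) * a k * d ^ (n - k))) A"
proof -
  have "((\<lambda>i. \<Sum>k\<le>n. of_nat (n choose k) * d ^ (n - k) * (x i ^ k * w i)) has_sum
          (\<Sum>k\<le>n. of_nat (n choose k) * d ^ (n - k) * a k)) A"
    by (intro has_sum_sum has_sum_cmult_right assms)
  then show ?thesis
    by (simp add: binomial_ring sum_distrib_left sum_distrib_right mult_ac)
qed

section \<open>The moments corrected for grouping\<close>

theorem theorem3p4:
  fixes m :: nat and h :: real and f :: "real \<Rightarrow> real"
    and M :: "'a measure" and X :: "'a \<Rightarrow> real"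
    and a a' :: "nat \<Rightarrow> real"
    and E :: "'u umbral_poly \<Rightarrow> real poly"
    and \<epsilon> \<alpha> \<alpha>' \<iota> \<iota>' :: 'u
  assumes "m > 0" and "h > 0"
    and "prob_space M" and "X \<in> borel_measurable M"
    and "\<And>n::nat. integrable M (\<lambda>\<omega>. \<bar>X \<omega>\<bar> ^ n)"
    and "\<And>i::int. measure M {\<omega> \<in> space M. X \<omega> = of_int i * h / of_nat m}
            = h / of_nat m * f (of_int i * h / of_nat m)"
    and "\<And>i::int. f (of_int i * h / of_nat m) \<ge> 0"
    and "((\<lambda>i::int. h / of_nat m * f (of_int i * h / of_nat m)) has_sum 1) UNIV"
    and "\<And>n. a n = h / of_nat m *
            (\<Sum>\<^sub>\<infinity>s::int. (of_int s * h / of_nat m) ^ n * f (of_int s * h / of_nat m))"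
    and "\<And>n. a' n = 1 / of_nat m * (\<Sum>j<m. h / of_nat m *
            (\<Sum>\<^sub>\<infinity>s::int.
              (of_int s * h / of_nat m - (of_nat m - 1 - 2 * of_nat j) / (2 * of_nat m) * h) ^ n
                * f (of_int s * h / of_nat m)))"
    and "umbral_calculus E \<epsilon>"
    and "umbrally_represents E \<alpha>' (\<lambda>n. [:a' n:])"
    and "umbrally_represents E \<alpha> (\<lambda>n. [:a n:])"
    and "bernoulli_umbra E \<iota>"
    and "inverse_umbra E \<epsilon> \<iota> \<iota>'"
    and "\<alpha> \<noteq> \<iota>" and "\<alpha> \<noteq> \<iota>'"
  shows "similar E (umb \<alpha>')
    (umb \<alpha> + real_const h * (umb \<iota>' - real_const (1 / 2))
           + real_const (h / of_nat m) * (umb \<iota> + real_const (1 / 2)))"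
proof -
  note m = \<open>m > 0\<close> and h = \<open>h > 0\<close> and moments = assms(5) and prob = assms(6)
    and nonneg = assms(7) and a = assms(9) and a' = assms(10) and calc = assms(11)
    and rep_\<alpha>' = assms(12) and rep_\<alpha> = assms(13) and \<iota> = assms(14) and inv = assms(15)
  interpret umbral_calculus E \<epsilon> by (rule calc)
  define g where "g = h / of_nat m"
  \<comment> \<open>the centring constant: the sum of \<open>- h / 2\<close> and \<open>h / (2 m)\<close>\<close>
  define c where "c = g / 2 - h / 2"
  define x where "x = (\<lambda>i::int. of_int i * h / of_nat m :: real)"
  define w where "w = (\<lambda>i. g * f (x i))"
  have "g > 0" and hg: "of_nat m * g = h"
    using m h by (simp_all add: g_def)
  have "inj x"
    using m h by (auto simp: inj_def x_def)

  have a_sum: "((\<lambda>i. x i ^ k * w i) has_sum a k) UNIV" for k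
  proof -
    have "finite_measure M" using \<open>prob_space M\<close> by (rule prob_space.finite_measure)
    from summable_on_atoms[OF this assms(4) moments _ \<open>inj x\<close>, of k]
    have "(\<lambda>i. \<bar>x i\<bar> ^ k * w i) summable_on UNIV"
      by (simp add: prob x_def w_def g_def)
    moreover have "norm (x i ^ k * w i) = \<bar>x i\<bar> ^ k * w i" for i
      using nonneg[of i] \<open>g > 0\<close> by (simp add: abs_mult power_abs w_def x_def)
    ultimately have "(\<lambda>i. norm (x i ^ k * w i)) summable_on UNIV"
      by (simp only:)
    then have "(\<lambda>i. x i ^ k * w i) summable_on UNIV"
      by (rule abs_summable_summable)
    moreover have "infsum (\<lambda>i. x i ^ k * w i) UNIV = a k"
      unfolding a infsum_cmult_right'[symmetric]
      by (intro infsum_cong) (simp add: x_def w_def g_def)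
    ultimately show ?thesis
      using has_sum_infsum by force
  qed

  have a'_eq: "a' n = 1 / of_nat m *
      (\<Sum>j<m. \<Sum>k\<le>n. of_nat (n choose k) * a k * (of_nat j * g + c) ^ (n - k))" for n
  proof -
    have "h / of_nat m * (\<Sum>\<^sub>\<infinity>s::int.
              (of_int s * h / of_nat m - (of_nat m - 1 - 2 * of_nat j) / (2 * of_nat m) * h) ^ n
                * f (of_int s * h / of_nat m))
        = (\<Sum>k\<le>n. of_nat (n choose k) * a k * (of_nat j * g + c) ^ (n - k))" for j :: nat
    proof -
      have shift: "y - (of_nat m - 1 - 2 * of_nat j) / (2 * of_nat m) * h
                     = y + (of_nat j * g + c)" for y
        using m by (simp add: g_def c_def field_simps)
      have "h / of_nat m * (\<Sum>\<^sub>\<infinity>s::int.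
              (of_int s * h / of_nat m - (of_nat m - 1 - 2 * of_nat j) / (2 * of_nat m) * h) ^ n
                * f (of_int s * h / of_nat m))
          = (\<Sum>\<^sub>\<infinity>s. (x s + (of_nat j * g + c)) ^ n * w s)"
        unfolding shift infsum_cmult_right'[symmetric]
        by (intro infsum_cong) (simp add: x_def w_def g_def)
      also have "\<dots> = (\<Sum>k\<le>n. of_nat (n choose k) * a k * (of_nat j * g + c) ^ (n - k))"
        by (rule infsumI[OF has_sum_shifted_power[OF a_sum]])
      finally show ?thesis .
    qed
    then show ?thesis by (simp add: a')
  qed

  have c_split: "real_const c = real_const (g * (1 / 2)) - real_const (h * (1 / 2))"
    by (simp add: c_def flip: real_const_diff)
  have rhs: "umb \<alpha> + real_const h * (umb \<iota>' - real_const (1 / 2))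
           + real_const (h / of_nat m) * (umb \<iota> + real_const (1 / 2))
      = umb \<alpha> + (real_const (of_nat m * g) * umb \<iota>' + real_const g * umb \<iota> + real_const c)"
    unfolding hg c_split g_def[symmetric] real_const_mult by (simp add: algebra_simps)
  have "E (umb \<alpha>' ^ n) = [:a' n:]" for n
    using rep_\<alpha>' by (simp add: umbrally_represents_def)
  then show ?thesis
    unfolding similar_def umbrally_equivalent_def rhs
      eval_uniform_grid_shift[OF \<iota> inv m assms(16,17) rep_\<alpha>] a'_eq
    by blast
qed

end
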